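(* Let $p$ and $q$ be elements of $D$. If $\deg p$ and $\deg q$ are odd and either $p$ or $q$ has a unique root (in $\mathbb{R}$), then the matrix $\begin{pmatrix} p & q\\ 0 & 0\end{pmatrix}\in M_2(D)$ is a product of idempotent matrices over $D$.
   Context: $D$ denotes the minimal Dress ring of $\mathbb{R}(X)$, i.e. the subring of $\mathbb{R}(X)$ generated by all elements $1/(1+x^2)$ with $x\in\mathbb{R}(X)$. Let $\Gamma$ be the set of polynomials in $\mathbb{R}[X]$ having no roots in $\mathbb{R}$ (including nonzero constants). It is known that $D=\{f/\gamma : f\in\mathbb{R}[X],\ \gamma\in\Gamma,\ \deg f\le\deg\gamma\}$. For a nonzero $p=f/\gamma\in D$, $\deg p=\deg f-\deg\gamma\le 0$. Roots are real roots, and "unique root" means exactly one distinct real root, of arbitrary multiplicity. A matrix $\mathbf{T}$ is idempotent if $\mathbf{T}^2=\mathbf{T}$. *)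

theory Defs
  imports
    "HOL-Analysis.Analysis"
    "HOL-Computational_Algebra.Computational_Algebra"
    "HOL-Computational_Algebra.Field_as_Ring"
begin

text \<open>
  Since \<open>-1\<close> is not a square in \<open>\<real>(X)\<close>, the denominators \<open>1 + x\<^sup>2\<close> below never vanish.
\<close>

inductive_set dress_ring :: "real poly fract set" where
  gen: "1 / (1 + x\<^sup>2) \<in> dress_ring"
| one: "1 \<in> dress_ring"
| diff: "a \<in> dress_ring \<Longrightarrow> b \<in> dress_ring \<Longrightarrow> a - b \<in> dress_ring"
| mult: "a \<in> dress_ring \<Longrightarrow> b \<in> dress_ring \<Longrightarrow> a * b \<in> dress_ring"

text \<open>
  The degree of a rational function, read off its reduced representation; the lemma
  \<open>rat_degree_Fract\<close> shows that any other representation gives the same value.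
  The convention is \<open>rat_degree 0 = 0\<close>, so an element of odd degree is nonzero.
\<close>

definition rat_degree :: "real poly fract \<Rightarrow> int" where
  "rat_degree p = (case quot_of_fract p of (f, g) \<Rightarrow> int (degree f) - int (degree g))"

text \<open>
  A real root of a rational function is a root of its reduced numerator. By \<open>rat_root_Fract\<close>,
  for a fraction whose denominator has no real root these are exactly the roots of the numerator.
\<close>

definition rat_root :: "real poly fract \<Rightarrow> real \<Rightarrow> bool" where
  "rat_root p a \<longleftrightarrow> poly (fst (quot_of_fract p)) a = 0"

definition matrices_over :: "'a set \<Rightarrow> ('a ^ 'n ^ 'm) set" where
  "matrices_over R = {T. \<forall>i j. T $ i $ j \<in> R}"

definition idempotent_matrix :: "('a::semiring_1) ^ 'n ^ 'n \<Rightarrow> bool" where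
  "idempotent_matrix T \<longleftrightarrow> T ** T = T"

definition product_of_idempotents_over :: "'a set \<Rightarrow> ('a::semiring_1) ^ 'n ^ 'n \<Rightarrow> bool" where
  "product_of_idempotents_over R M \<longleftrightarrow>
     (\<exists>Ts. (\<forall>T\<in>set Ts. T \<in> matrices_over R \<and> idempotent_matrix T) \<and>
       M = foldr (**) Ts (mat 1))"

lemma quot_of_fract_cross:
  fixes f g :: "real poly"
  assumes "g \<noteq> 0"
  shows "f * snd (quot_of_fract (Fract f g)) = fst (quot_of_fract (Fract f g)) * g"
proof -
  let ?q = "quot_of_fract (Fract f g)"
  have "Fract (fst ?q) (snd ?q) = Fract f g"
    by (rule Fract_quot_of_fract)
  then show ?thesis
    using assms by (metis Fraction_Field.eq_fract(1) snd_quot_of_fract_nonzero mult.commute)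
qed

lemma rat_degree_Fract:
  assumes "f \<noteq> 0" "g \<noteq> 0"
  shows "rat_degree (Fract f g) = int (degree f) - int (degree g)"
proof -
  let ?q = "quot_of_fract (Fract f g)"
  have c: "f * snd ?q = fst ?q * g"
    by (rule quot_of_fract_cross) fact
  have s: "snd ?q \<noteq> 0" by simp
  have "fst ?q \<noteq> 0" using c s assms by auto
  then have "degree f + degree (snd ?q) = degree (fst ?q) + degree g"
    using arg_cong[OF c, of degree] s assms by (simp add: degree_mult_eq)
  then show ?thesis by (simp add: rat_degree_def case_prod_beta)
qed

lemma rat_degree_zero: "rat_degree 0 = 0"
  by (simp add: rat_degree_def)

lemma rat_root_Fract:
  assumes "poly g a \<noteq> 0"
  shows "rat_root (Fract f g) a \<longleftrightarrow> poly f a = 0"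
proof -
  let ?q = "quot_of_fract (Fract f g)"
  have "g \<noteq> 0" using assms by auto
  then have c: "poly f a * poly (snd ?q) a = poly (fst ?q) a * poly g a"
    using quot_of_fract_cross[of g f] by (metis poly_mult)
  have "coprime (fst ?q) (snd ?q)" by (rule coprime_quot_of_fract)
  then have "\<not> (poly (fst ?q) a = 0 \<and> poly (snd ?q) a = 0)"
    by (metis coprime_poly_0)
  then show ?thesis using c assms by (auto simp: rat_root_def)
qed

end

theory Submission imports Defs begin

text \<open>
  The ring \<open>D\<close> consists of the rational functions without poles on the real projective line, a circle:
  the fractions \<open>f/g\<close> with \<open>g\<close> free of real roots and \<open>deg f \<le> deg g\<close> (\<open>dress_ring_imp_Fract\<close>,
  \<open>Fract_in_dress_ring\<close>). The order of such an element at infinity is minus its degree, and the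
  total order over the whole circle is even. Hence an entry \<open>p\<close> of odd degree with the unique real
  root \<open>a\<close> vanishes exactly at \<open>a\<close> and at infinity, to odd order at both places, so it changes
  sign there and nowhere else.

  Say that a row \<open>(p, q)\<close> factors if the matrix with first row \<open>(p, q)\<close> and second row zero is a
  product of idempotents over \<open>D\<close>. This property is kept when the row is scaled by an element of
  \<open>D\<close>, when its entries are exchanged and when a multiple of one entry is added to the other
  (\<open>row_factors_scale\<close>, \<open>row_factors_swap\<close>, \<open>row_factors_add_multiple\<close>). A row with an
  entry that is a unit therefore factors. Moreover, if \<open>E\<close> is idempotent and \<open>(p, q) = (p', q') E\<close>,
  then it suffices to factor \<open>(p', q')\<close> (\<open>row_factors_projection\<close>). The aim is to reach a unit.

  Let \<open>m\<close> be the smaller of the orders of \<open>p\<close> and \<open>q\<close> at \<open>a\<close>. Dividing the row by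
  \<open>(X - a)\<^sup>m\<close>, and by as high a power of \<open>1/(1 + X\<^sup>2)\<close> as the orders at infinity
  permit, leaves two cases.

  If \<open>m\<close> is odd, the reduced entries have even degrees and no common zero on the circle, and the
  reduced \<open>p\<close> has constant sign \<open>\<epsilon>\<close>. Then \<open>p + \<epsilon> q\<^sup>2\<close> vanishes nowhere, so it is a unit
  (\<open>row_factors_no_sign_change\<close>).

  If \<open>m\<close> is even, infinity remains a common zero, of order one in at least one entry, and after
  adding one entry to the other it is of order one in \<open>q\<close>; also \<open>q\<close> does not vanish at \<open>a\<close>. The
  common zero rules out a unit combination of the entries. But for real constants \<open>C\<close> and \<open>L\<close> the
  function \<open>p + L (1 + X\<^sup>2) (q - C p)\<^sup>2\<close>, whose second summand does not vanish at infinity, can be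
  made nonzero on the whole circle: on one of the two arcs between \<open>a\<close> and infinity a suitable
  \<open>C\<close> makes \<open>q - C p\<close> zero-free, so that a large \<open>L\<close> lets the square win there, while on the
  other arc \<open>p\<close> already has the sign of \<open>L\<close> (\<open>perturbed_rootless_ex\<close>). This unit is the first entry
  of a row \<open>(p', q')\<close> from which the idempotent with row space spanned by \<open>(p, q)\<close> and column
  space spanned by \<open>(p + C q, q - C p)\<close> produces \<open>(p, q)\<close>
  (\<open>row_factors_simple_zero_at_infinity\<close>).
\<close>

section \<open>Products of idempotents with a single nonzero row\<close>

definition mat2 :: "'a::zero \<Rightarrow> 'a \<Rightarrow> 'a \<Rightarrow> 'a \<Rightarrow> 'a ^ 2 ^ 2" where
  "mat2 a b c d = vector [vector [a, b], vector [c, d]]"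

lemma mat2_nth [simp]:
  "mat2 a b c d $ 1 $ 1 = a" "mat2 a b c d $ 1 $ 2 = b"
  "mat2 a b c d $ 2 $ 1 = c" "mat2 a b c d $ 2 $ 2 = d"
  by (simp_all add: mat2_def)

lemma mat2_mult:
  fixes a :: "'a::semiring_1"
  shows "mat2 a b c d ** mat2 a' b' c' d' =
    mat2 (a * a' + b * c') (a * b' + b * d') (c * a' + d * c') (c * b' + d * d')"
  by (simp add: vec_eq_iff forall_2 matrix_matrix_mult_def sum_2)

lemma mat_1_eq_mat2: "(mat 1 :: 'a::semiring_1 ^ 2 ^ 2) = mat2 1 0 0 1"
  by (simp add: vec_eq_iff forall_2 mat_def)

lemma mat2_in_matrices_over:
  "mat2 a b c d \<in> matrices_over R \<longleftrightarrow> a \<in> R \<and> b \<in> R \<and> c \<in> R \<and> d \<in> R"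
  by (auto simp: matrices_over_def forall_2)

lemma mat2_eq_iff:
  "mat2 a b c d = mat2 a' b' c' d' \<longleftrightarrow> a = a' \<and> b = b' \<and> c = c' \<and> d = d'"
  by (auto simp: vec_eq_iff forall_2)

lemma idempotent_imp_product_of_idempotents:
  assumes "T \<in> matrices_over R" "idempotent_matrix T"
  shows "product_of_idempotents_over R T"
  unfolding product_of_idempotents_over_def using assms
  by (intro exI[of _ "[T]"]) (simp add: matrix_mul_rid)

lemma foldr_matrix_mult_append:
  fixes Ts :: "('a::semiring_1 ^ 'n ^ 'n) list"
  shows "foldr (**) (Ts @ Us) (mat 1) = foldr (**) Ts (mat 1) ** foldr (**) Us (mat 1)"
  by (induction Ts) (simp_all add: matrix_mul_assoc matrix_mul_lid)

lemma product_of_idempotents_mult: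
  assumes "product_of_idempotents_over R A" "product_of_idempotents_over R B"
  shows "product_of_idempotents_over R (A ** B)"
proof -
  obtain Ts Us where "\<forall>T\<in>set Ts. T \<in> matrices_over R \<and> idempotent_matrix T"
    "A = foldr (**) Ts (mat 1)" "\<forall>T\<in>set Us. T \<in> matrices_over R \<and> idempotent_matrix T"
    "B = foldr (**) Us (mat 1)"
    using assms unfolding product_of_idempotents_over_def by blast
  then show ?thesis unfolding product_of_idempotents_over_def
    by (intro exI[of _ "Ts @ Us"]) (auto simp: foldr_matrix_mult_append simp del: foldr_append)
qed

locale subring_set =
  fixes R :: "'a::comm_ring_1 set"
  assumes one_in: "1 \<in> R"
    and diff_in: "a \<in> R \<Longrightarrow> b \<in> R \<Longrightarrow> a - b \<in> R"
    and mult_in: "a \<in> R \<Longrightarrow> b \<in> R \<Longrightarrow> a * b \<in> R"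
begin

lemma zero_in: "0 \<in> R"
  using diff_in[OF one_in one_in] by simp

lemma uminus_in: "a \<in> R \<Longrightarrow> - a \<in> R"
  using diff_in[OF zero_in] by simp

lemma add_in: "a \<in> R \<Longrightarrow> b \<in> R \<Longrightarrow> a + b \<in> R"
  using diff_in[OF _ uminus_in] by fastforce

lemmas closed_in = zero_in one_in diff_in uminus_in add_in mult_in

abbreviation row_factors :: "'a \<Rightarrow> 'a \<Rightarrow> bool" where
  "row_factors p q \<equiv> product_of_idempotents_over R (mat2 p q 0 0)"

lemma row_factors_mult_idempotent:
  assumes "row_factors p q" "mat2 a b c d \<in> matrices_over R" "idempotent_matrix (mat2 a b c d)"
  shows "row_factors (p * a + q * c) (p * b + q * d)"
  using product_of_idempotents_mult[OF assms(1) idempotent_imp_product_of_idempotents[OF assms(2,3)]]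
  by (simp add: mat2_mult)

lemma row_factors_1:
  assumes "q \<in> R"
  shows "row_factors 1 q"
  by (rule idempotent_imp_product_of_idempotents)
     (use assms in \<open>auto simp: mat2_in_matrices_over closed_in idempotent_matrix_def mat2_mult\<close>)

lemma row_factors_0_left:
  assumes "q \<in> R"
  shows "row_factors 0 q"
  using row_factors_mult_idempotent[OF row_factors_1[OF assms], of 0 0 0 1]
  by (simp add: mat2_in_matrices_over closed_in idempotent_matrix_def mat2_mult)

text \<open>
  The value \<open>p\<close> is moved from the second place, where \<open>row_factors_0_left\<close> puts it, to the first
  by two idempotents in succession: one copies it to both places, the next erases the second copy.
\<close>

lemma row_factors_0_right:
  assumes "p \<in> R"
  shows "row_factors p 0"
proof -
  have "row_factors p p"
    using row_factors_mult_idempotent[OF row_factors_0_left[OF assms], of 0 0 1 1]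
    by (simp add: mat2_in_matrices_over closed_in idempotent_matrix_def mat2_mult)
  from row_factors_mult_idempotent[OF this, of 1 0 0 0] show ?thesis
    by (simp add: mat2_in_matrices_over closed_in idempotent_matrix_def mat2_mult)
qed

lemma row_factors_scale:
  assumes "row_factors p q" "d \<in> R"
  shows "row_factors (d * p) (d * q)"
  using product_of_idempotents_mult[OF row_factors_0_right[OF assms(2)] assms(1)]
  by (simp add: mat2_mult)

lemma matrices_over_mult:
  fixes A B :: "'a ^ 2 ^ 2"
  assumes "A \<in> matrices_over R" "B \<in> matrices_over R"
  shows "A ** B \<in> matrices_over R"
  using assms by (auto simp: matrices_over_def matrix_matrix_mult_def sum_2 closed_in)

text \<open>
  Conjugation by a matrix that is invertible over the ring sends idempotents to idempotents and
  commutes with products.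
\<close>

lemma product_of_idempotents_conjugate:
  fixes M U V :: "'a ^ 2 ^ 2"
  assumes M: "product_of_idempotents_over R M"
    and UV: "U \<in> matrices_over R" "V \<in> matrices_over R" "U ** V = mat 1" "V ** U = mat 1"
  shows "product_of_idempotents_over R (V ** M ** U)"
proof -
  obtain Ts where Ts: "\<forall>T\<in>set Ts. T \<in> matrices_over R \<and> idempotent_matrix T"
    "M = foldr (**) Ts (mat 1)"
    using M unfolding product_of_idempotents_over_def by blast
  have idem: "idempotent_matrix (V ** T ** U)" if "idempotent_matrix T" for T
  proof -
    have "V ** T ** U ** (V ** T ** U) = V ** T ** (U ** V) ** T ** U"
      by (simp only: matrix_mul_assoc)
    also have "\<dots> = V ** (T ** T) ** U" by (simp add: UV matrix_mul_rid matrix_mul_assoc)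
    finally show ?thesis using that by (simp add: idempotent_matrix_def)
  qed
  have conj: "foldr (**) (map (\<lambda>T. V ** T ** U) Ts) (mat 1) = V ** foldr (**) Ts (mat 1) ** U" for Ts
  proof (induction Ts)
    case Nil
    show ?case by (simp add: UV matrix_mul_rid)
  next
    case (Cons T Ts)
    let ?N = "foldr (**) Ts (mat 1)"
    have "V ** T ** U ** (V ** ?N ** U) = V ** T ** (U ** V) ** ?N ** U"
      by (simp only: matrix_mul_assoc)
    also have "\<dots> = V ** (T ** ?N) ** U" by (simp add: UV matrix_mul_rid matrix_mul_assoc)
    finally show ?case using Cons by simp
  qed
  show ?thesis unfolding product_of_idempotents_over_def
    using Ts idem UV by (intro exI[of _ "map (\<lambda>T. V ** T ** U) Ts"])
      (auto simp: conj intro!: matrices_over_mult)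
qed

text \<open>
  Conjugating the row matrix by \<open>U\<close> multiplies the row by \<open>U\<close>, but it also moves the column
  space from the first basis vector \<open>e\<close> to \<open>V e\<close>, where \<open>V\<close> is the inverse of \<open>U\<close>. The matrix
  whose first row is the first row \<open>(a, b)\<close> of \<open>U\<close> and whose second row is zero takes \<open>V e\<close>
  back to \<open>e\<close>, because \<open>U V = 1\<close>.
\<close>

lemma row_factors_mult_invertible:
  assumes pq: "row_factors p q"
    and U: "mat2 a b c d \<in> matrices_over R" and V: "mat2 a' b' c' d' \<in> matrices_over R"
    and UV: "mat2 a b c d ** mat2 a' b' c' d' = mat 1" "mat2 a' b' c' d' ** mat2 a b c d = mat 1"
    and ab: "row_factors a b"
  shows "row_factors (p * a + q * c) (p * b + q * d)"
proof -
  have "mat2 a b 0 0 ** (mat2 a' b' c' d' ** mat2 p q 0 0 ** mat2 a b c d) =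
      mat2 (p * a + q * c) (p * b + q * d) 0 0"
  proof -
    have e: "a * a' + b * c' = 1" using UV(1) by (simp add: mat2_mult mat_1_eq_mat2 mat2_eq_iff)
    have "mat2 a b 0 0 ** mat2 a' b' c' d' ** mat2 p q 0 0 = mat2 p q 0 0"
      by (simp add: mat2_mult e)
    then have "mat2 a b 0 0 ** (mat2 a' b' c' d' ** mat2 p q 0 0 ** mat2 a b c d) =
      mat2 p q 0 0 ** mat2 a b c d" by (metis matrix_mul_assoc)
    then show ?thesis by (simp add: mat2_mult)
  qed
  then show ?thesis
    using product_of_idempotents_mult[OF ab product_of_idempotents_conjugate[OF pq U V UV]] by simp
qed

lemma row_factors_swap:
  assumes "row_factors p q"
  shows "row_factors q p"
  using row_factors_mult_invertible[OF assms, of 0 1 1 0 0 1 1 0]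
  by (simp add: mat2_in_matrices_over closed_in mat2_mult mat_1_eq_mat2 row_factors_0_left)

lemma row_factors_add_multiple:
  assumes "row_factors p q" "s \<in> R"
  shows "row_factors p (q + s * p)"
  using row_factors_mult_invertible[OF assms(1), of 1 s 0 1 1 "-s" 0 1] assms(2)
  by (simp add: mat2_in_matrices_over closed_in mat2_mult mat_1_eq_mat2 row_factors_1 algebra_simps)

lemma row_factors_unit:
  assumes "u \<in> R" "u' \<in> R" "u * u' = 1" "q \<in> R"
  shows "row_factors u q"
  using row_factors_add_multiple[OF row_factors_0_right[OF assms(1)], of "q * u'"] assms
  by (simp add: closed_in mult.assoc mult.commute[of u' u])

text \<open>
  An elementary operation replaces \<open>p\<close> by a unit, and another one undoes it at the end.
\<close>

lemma row_factors_combination_unit: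
  assumes "q \<in> R" "s \<in> R" "p + s * q \<in> R" "u' \<in> R" "(p + s * q) * u' = 1"
  shows "row_factors p q"
proof -
  have "row_factors q (p + s * q)"
    by (rule row_factors_swap[OF row_factors_unit]) (use assms in auto)
  from row_factors_add_multiple[OF this, of "- s"] show ?thesis
    using assms(2) by (simp add: closed_in row_factors_swap)
qed

text \<open>
  The vector with entries \<open>v\<close>, \<open>w\<close> times the row \<open>(p, q)\<close> is the projection onto the line of that
  vector along the kernel of the row. It fixes \<open>(p, q)\<close>, and it kills every row that is
  orthogonal to \<open>(v, w)\<close>, in particular \<open>(t w, - t v)\<close>. Only the entries of the projection
  have to lie in the ring; \<open>v\<close>, \<open>w\<close> and \<open>t\<close> may be arbitrary. This freedom is what makes the lemma
  applicable to a row that generates a nonprincipal ideal.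
\<close>

lemma row_factors_projection:
  assumes v: "p * v + q * w = 1"
    and R: "p * v \<in> R" "q * v \<in> R" "p * w \<in> R" "q * w \<in> R"
    and row: "row_factors (p + t * w) (q - t * v)"
  shows "row_factors p q"
proof -
  have "idempotent_matrix (mat2 (p * v) (q * v) (p * w) (q * w))"
  proof -
    have e: "p * v * (z * y) + q * y * (z * w) = z * y" for z y
    proof -
      have "p * v * (z * y) + q * y * (z * w) = (p * v + q * w) * (z * y)" by (simp add: algebra_simps)
      then show ?thesis by (simp add: v)
    qed
    have e': "p * w * (z * v) + q * w * (z * w) = z * w" for z
    proof -
      have "p * w * (z * v) + q * w * (z * w) = (p * v + q * w) * (z * w)" by (simp add: algebra_simps)
      then show ?thesis by (simp add: v)
    qed
    show ?thesis
      by (simp add: idempotent_matrix_def mat2_mult mat2_eq_iff e e')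
  qed
  from row_factors_mult_idempotent[OF row _ this] R
  have "row_factors ((p + t * w) * (p * v) + (q - t * v) * (p * w))
      ((p + t * w) * (q * v) + (q - t * v) * (q * w))"
    by (simp add: mat2_in_matrices_over)
  moreover have "(p + t * w) * (z * v) + (q - t * v) * (z * w) = z" for z
  proof -
    have "(p + t * w) * (z * v) + (q - t * v) * (z * w) = z * (p * v + q * w)"
      by (simp add: algebra_simps)
    then show ?thesis by (simp add: v)
  qed
  ultimately show ?thesis by simp
qed

end

section \<open>Real polynomials and their signs\<close>

definition rootless :: "real poly \<Rightarrow> bool" where
  "rootless g \<longleftrightarrow> (\<forall>x. poly g x \<noteq> 0)"

lemma rootless_nonzero: "rootless g \<Longrightarrow> g \<noteq> 0"
  by (auto simp: rootless_def)

lemma rootless_mult: "rootless f \<Longrightarrow> rootless g \<Longrightarrow> rootless (f * g)"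
  by (simp add: rootless_def)

lemma rootless_power: "rootless f \<Longrightarrow> rootless (f ^ n)"
  by (simp add: rootless_def)

lemma eventually_poly_pos:
  fixes p :: "real poly"
  assumes "lead_coeff p > 0"
  shows "eventually (\<lambda>x. poly p x > 0) at_top"
  using poly_pinfty_gt_lc[OF assms] assms
  by (auto simp: eventually_at_top_linorder intro: less_le_trans)

lemma lead_coeff_nonneg:
  fixes p :: "real poly"
  assumes "eventually (\<lambda>x. poly p x \<ge> 0) at_top"
  shows "lead_coeff p \<ge> 0"
proof (rule ccontr)
  assume "\<not> lead_coeff p \<ge> 0"
  then have "eventually (\<lambda>x. poly (- p) x > 0) at_top"
    by (intro eventually_poly_pos) simp
  with assms have "eventually (\<lambda>x. False) (at_top :: real filter)"
    by eventually_elim auto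
  then show False by simp
qed

lemma lead_coeff_reflect:
  fixes p :: "real poly"
  shows "lead_coeff (p \<circ>\<^sub>p [:0, -1:]) = (- 1) ^ degree p * lead_coeff p"
  by (subst lead_coeff_comp) (auto simp: mult.commute)

lemma odd_degree_imp_root:
  fixes p :: "real poly"
  assumes "odd (degree p)"
  shows "\<exists>x. poly p x = 0"
proof -
  have *: "\<exists>x. poly p x = 0" if p: "odd (degree p)" "lead_coeff p > 0" for p :: "real poly"
  proof -
    obtain x where x: "poly p x > 0"
      using eventually_happens'[OF _ eventually_poly_pos[OF p(2)]] by auto
    have "lead_coeff (- (p \<circ>\<^sub>p [:0, -1:])) > 0"
      using p by (simp only: lead_coeff_minus lead_coeff_reflect) simp
    from eventually_happens'[OF _ eventually_poly_pos[OF this]] obtain y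
      where y: "poly p (- y) < 0" by (auto simp: poly_pcompose)
    have "x \<noteq> - y" using x y by auto
    then show ?thesis using x y poly_IVT[of x "- y" p] poly_IVT[of "- y" x p]
      by (metis linorder_neqE mult_neg_pos mult_pos_neg)
  qed
  have "lead_coeff p \<noteq> 0" using assms by (metis degree_0 even_zero leading_coeff_0_iff)
  then consider "lead_coeff p > 0" | "lead_coeff (- p) > 0" by fastforce
  then show ?thesis
    using assms *[of p] *[of "- p"] by cases simp_all
qed

lemma rootless_even_degree: "rootless g \<Longrightarrow> even (degree g)"
  using odd_degree_imp_root by (auto simp: rootless_def)

lemma coeff_mult_le:
  fixes p q :: "'a::comm_semiring_0 poly"
  assumes "degree p \<le> m" "degree q \<le> n"
  shows "coeff (p * q) (m + n) = coeff p m * coeff q n"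
proof (cases "degree p = m \<and> degree q = n")
  case True
  then show ?thesis using coeff_mult_degree_sum[of p q] by simp
next
  case False
  then have "degree p + degree q < m + n" using assms by linarith
  then have "degree (p * q) < m + n" using degree_mult_le le_less_trans by blast
  then have "coeff (p * q) (m + n) = 0" by (rule coeff_eq_0)
  moreover have "degree p < m \<or> degree q < n" using False assms by linarith
  then have "coeff p m = 0 \<or> coeff q n = 0" using coeff_eq_0 by blast
  ultimately show ?thesis by (metis mult_zero_left mult_zero_right)
qed

text \<open>
  The leading coefficients of nonzero squares are positive and cannot cancel.
\<close>

lemma degree_add_mult_self:
  fixes f g :: "real poly"
  shows "degree (f * f + g * g) = 2 * max (degree f) (degree g)"
proof -
  have *: "degree (f * f + g * g) = 2 * max (degree f) (degree g)" if "degree f \<le> degree g"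
    for f g :: "real poly"
  proof (cases "g = 0")
    case False
    let ?n = "degree g"
    have "coeff (f * f) (?n + ?n) = coeff f ?n * coeff f ?n"
      using that by (intro coeff_mult_le)
    then have "coeff (f * f + g * g) (?n + ?n) = (coeff f ?n)^2 + (lead_coeff g)^2"
      by (simp add: coeff_mult_degree_sum power2_eq_square)
    also have "\<dots> > 0" using False by (simp add: sum_power2_gt_zero_iff)
    finally have "degree (f * f + g * g) \<ge> ?n + ?n" by (intro le_degree) simp
    moreover have "degree (f * f + g * g) \<le> ?n + ?n"
      using that by (intro degree_add_le order.trans[OF degree_mult_le]) auto
    ultimately show ?thesis using that by simp
  qed (use that degree_mult_le[of f f] in simp)
  show ?thesis
    using *[of f g] *[of g f] by (cases "degree f \<le> degree g") (simp_all add: add.commute max.commute)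
qed

lemma unique_root_sign_right:
  fixes f :: "real poly"
  assumes "lead_coeff f > 0" "\<And>x. poly f x = 0 \<Longrightarrow> x = a" "x > a"
  shows "poly f x > 0"
proof (rule ccontr)
  assume "\<not> poly f x > 0"
  then have x: "poly f x < 0" using assms(2)[of x] assms(3) by fastforce
  have "eventually (\<lambda>y. poly f y > 0 \<and> y > x) at_top"
    using eventually_poly_pos[OF assms(1)] eventually_gt_at_top[of x] by eventually_elim auto
  then obtain y where "poly f y > 0" "y > x"
    using eventually_happens'[OF trivial_limit_at_top_linorder] by blast
  then show False using poly_IVT_pos[of x y f] x assms(2,3) by force
qed

lemma unique_root_sign_left:
  fixes f :: "real poly"
  assumes "lead_coeff f > 0" "odd (degree f)" "\<And>x. poly f x = 0 \<Longrightarrow> x = a" "x < a"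
  shows "poly f x < 0"
proof -
  have "lead_coeff (- (f \<circ>\<^sub>p [:0, -1:])) > 0"
    using assms(1,2) by (simp only: lead_coeff_minus lead_coeff_reflect) simp
  from unique_root_sign_right[OF this, of "- a" "- x"] show ?thesis
    using assms(3,4) by (force simp: poly_pcompose)
qed

definition X2_plus_1 :: "real poly" where "X2_plus_1 = [:1, 0, 1:]"

lemma poly_X2_plus_1: "poly X2_plus_1 x = 1 + x\<^sup>2"
  by (simp add: X2_plus_1_def power2_eq_square)

lemma poly_X2_plus_1_pos: "poly X2_plus_1 x > 0"
  by (simp add: poly_X2_plus_1 add_pos_nonneg)

lemma rootless_X2_plus_1: "rootless X2_plus_1"
  using poly_X2_plus_1_pos by (simp add: rootless_def less_imp_neq[symmetric])

lemma degree_X2_plus_1: "degree X2_plus_1 = 2"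
  by (simp add: X2_plus_1_def)

lemma lead_coeff_X2_plus_1: "lead_coeff X2_plus_1 = 1"
  by (simp add: X2_plus_1_def)

lemma X2_plus_1_nonzero: "X2_plus_1 \<noteq> 0" by (simp add: X2_plus_1_def)

lemma degree_X2_plus_1_mult_square:
  assumes "degree h + 1 = 2 * n"
  shows "degree (X2_plus_1 * h\<^sup>2) = 4 * n"
proof -
  have "h \<noteq> 0" using assms by auto
  then have "degree (X2_plus_1 * h\<^sup>2) = 2 + 2 * degree h"
    using X2_plus_1_nonzero by (simp add: degree_mult_eq degree_power_eq degree_X2_plus_1)
  then show ?thesis using assms by simp
qed

lemma degree_mult_X2_plus_1_power:
  assumes "degree f + 1 \<le> 2 * n"
  shows "degree (f * X2_plus_1 ^ n) < 4 * n"
  using degree_mult_le[of f "X2_plus_1 ^ n"] assms X2_plus_1_nonzero by (simp add: degree_power_eq degree_X2_plus_1)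

section \<open>The minimal Dress ring as a ring of fractions\<close>

interpretation dress: subring_set dress_ring
  by standard (auto intro: dress_ring.intros)

text \<open>
  The generator with \<open>x = f/g\<close> in lowest terms is \<open>g\<^sup>2/(f\<^sup>2 + g\<^sup>2)\<close>, whose denominator has no
  real root because \<open>f\<close> and \<open>g\<close> have none in common.
\<close>

lemma dress_ring_imp_Fract:
  assumes "p \<in> dress_ring"
  shows "\<exists>f g. rootless g \<and> degree f \<le> degree g \<and> p = Fract f g"
  using assms
proof induction
  case (gen x)
  define f g where "f = fst (quot_of_fract x)" and "g = snd (quot_of_fract x)"
  have x: "x = Fract f g" by (simp add: f_def g_def)
  have g: "g \<noteq> 0" by (simp add: g_def)
  have "coprime f g" unfolding f_def g_def by (rule coprime_quot_of_fract)
  then have "\<not> (poly f a = 0 \<and> poly g a = 0)" for a by (metis coprime_poly_0)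
  then have r: "rootless (f * f + g * g)" by (simp add: rootless_def sum_squares_eq_zero_iff)
  have "1 / (1 + x\<^sup>2) = Fract (g * g) (f * f + g * g)"
    using g rootless_nonzero[OF r]
    by (simp add: x Fract_conv_to_fract power2_eq_square divide_simps flip: to_fract_add to_fract_mult)
  moreover have "degree (g * g) \<le> degree (f * f + g * g)"
    using degree_mult_le[of g g] by (simp add: degree_add_mult_self)
  ultimately show ?case using r by blast
next
  case one
  have "rootless 1" by (simp add: rootless_def)
  then show ?case by (intro exI[of _ 1]) (simp add: One_fract_def)
next
  case (diff a b)
  from diff.IH(1) obtain f g where a: "rootless g" "degree f \<le> degree g" "a = Fract f g" by blast
  from diff.IH(2) obtain h k where b: "rootless k" "degree h \<le> degree k" "b = Fract h k" by blast
  have nz: "g \<noteq> 0" "k \<noteq> 0" using a b rootless_nonzero by blast+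
  have "degree (f * k) \<le> degree (g * k)" "degree (h * g) \<le> degree (g * k)"
    using a(2) b(2) degree_mult_le[of f k] degree_mult_le[of h g] by (simp_all add: degree_mult_eq nz)
  then have "degree (f * k - h * g) \<le> degree (g * k)" by (rule degree_diff_le)
  moreover have "rootless (g * k)" using a b by (intro rootless_mult)
  moreover have "a - b = Fract (f * k - h * g) (g * k)" using nz by (simp add: a b)
  ultimately show ?case by blast
next
  case (mult a b)
  from mult.IH(1) obtain f g where a: "rootless g" "degree f \<le> degree g" "a = Fract f g" by blast
  from mult.IH(2) obtain h k where b: "rootless k" "degree h \<le> degree k" "b = Fract h k" by blast
  have nz: "g \<noteq> 0" "k \<noteq> 0" using a b rootless_nonzero by blast+
  have "degree (f * h) \<le> degree (g * k)"
    using a(2) b(2) degree_mult_le[of f h] by (simp add: degree_mult_eq nz)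
  moreover have "rootless (g * k)" using a b by (intro rootless_mult)
  moreover have "a * b = Fract (f * h) (g * k)" using nz by (simp add: a b)
  ultimately show ?case by blast
qed

text \<open>
  Every number in the interval \<open>(0, 1]\<close> has the form \<open>1/(1 + r\<^sup>2)\<close>, and every real number is an
  integer multiple of such a number.
\<close>

lemma to_fract_const_in_dress_ring: "to_fract [:c:] \<in> dress_ring"
proof -
  have nat: "of_nat n \<in> dress_ring" for n :: nat
    by (induction n) (auto intro: dress.closed_in)
  have unit_interval: "to_fract [:t:] \<in> dress_ring" if "0 < t" "t \<le> 1" for t
  proof -
    define r where "r = sqrt (1 / t - 1)"
    have "r\<^sup>2 = 1 / t - 1" using that by (simp add: r_def)
    then have "[:t:] * (1 + [:r:] * [:r:]) = 1"
      using that by (simp add: power2_eq_square one_pCons)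
    then have "to_fract ([:t:] * (1 + [:r:] * [:r:])) = 1" by (simp only: to_fract_1)
    then have "to_fract [:t:] * (1 + (to_fract [:r:])\<^sup>2) = 1"
      by (simp only: to_fract_mult to_fract_add to_fract_1 power2_eq_square)
    then have "to_fract [:t:] = 1 / (1 + (to_fract [:r:])\<^sup>2)"
      by (metis nonzero_eq_divide_eq mult_zero_right zero_neq_one)
    then show ?thesis by (simp add: dress_ring.gen)
  qed
  have pos: "to_fract [:c:] \<in> dress_ring" if "c > 0" for c
  proof -
    obtain n :: nat where n: "c < n" using reals_Archimedean2 by blast
    have "of_nat k = to_fract [:real k:]" for k
    proof (induction k)
      case (Suc k)
      have "of_nat (Suc k) = to_fract 1 + to_fract [:real k:]" by (simp add: Suc)
      also have "\<dots> = to_fract [:real (Suc k):]"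
        by (simp only: to_fract_add[symmetric]) (simp add: one_pCons)
      finally show ?case .
    qed simp
    then have "of_nat n * to_fract [:c / n:] = to_fract [:c:]"
      using n that by (simp flip: to_fract_mult)
    then have "to_fract [:c:] = of_nat n * to_fract [:c / n:]" ..
    then show ?thesis using n that by (auto intro!: dress.closed_in nat unit_interval)
  qed
  consider "c > 0" | "c = 0" | "- c > 0" by linarith
  then show ?thesis
  proof cases
    case 3
    have "to_fract [:c:] = - to_fract [:-c:]" by (simp flip: to_fract_uminus)
    then show ?thesis using pos[OF 3] dress.uminus_in by simp
  qed (auto simp: pos dress.closed_in)
qed

lemma sum_1_square_nonzero: "1 + (to_fract l)\<^sup>2 \<noteq> (0 :: real poly fract)"
proof
  assume "1 + (to_fract l)\<^sup>2 = (0 :: real poly fract)"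
  then have "1 + l * l = 0"
    by (simp add: power2_eq_square flip: to_fract_1 to_fract_add to_fract_mult)
  then have "poly (1 + l * l) 0 = 0" by simp
  then show False by (simp add: add_nonneg_eq_0_iff)
qed

text \<open>
  For \<open>y \<noteq> -1\<close>, the generator belonging to \<open>(y - 1)/(1 + y)\<close> is \<open>1/2 + y/(1 + y\<^sup>2)\<close>.
\<close>

lemma divide_1_plus_square_in_dress_ring:
  fixes l :: "real poly"
  shows "to_fract l / (1 + (to_fract l)\<^sup>2) \<in> dress_ring"
proof -
  define y where "y = to_fract l"
  have y: "1 + y\<^sup>2 \<noteq> 0" unfolding y_def by (rule sum_1_square_nonzero)
  have two: "(2 :: real poly fract) \<noteq> 0"
    by (metis to_fract_eq_0_iff to_fract_add to_fract_1 one_add_one zero_neq_numeral)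
  have half: "1 / 2 \<in> dress_ring"
  proof -
    have "2 * to_fract [:1 / 2:] = to_fract ([:1/2:] + [:1 / 2::real:])"
      by (simp only: to_fract_add mult_2)
    then have "to_fract [:1 / 2::real:] = 1 / 2"
      using two by (simp add: field_simps one_pCons[symmetric])
    then show ?thesis using to_fract_const_in_dress_ring by metis
  qed
  show ?thesis unfolding y_def[symmetric]
  proof (cases "y = - 1")
    case True
    then have "y / (1 + y\<^sup>2) = - (1 / 2)" by simp
    then show "y / (1 + y\<^sup>2) \<in> dress_ring" using dress.uminus_in[OF half] by simp
  next
    case False
    then have y1: "1 + y \<noteq> 0" by (metis add.commute eq_neg_iff_add_eq_0)
    have "1 + ((y - 1) / (1 + y))\<^sup>2 = 2 * (1 + y\<^sup>2) / (1 + y)\<^sup>2"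
    proof -
      have "1 + ((y - 1) / (1 + y))\<^sup>2 = ((1 + y)\<^sup>2 + (y - 1)\<^sup>2) / (1 + y)\<^sup>2"
        using y1 by (simp add: power_divide add_divide_distrib)
      also have "(1 + y)\<^sup>2 + (y - 1)\<^sup>2 = 2 * (1 + y\<^sup>2)"
        by (simp add: power2_eq_square algebra_simps)
      finally show ?thesis .
    qed
    then have "1 / (1 + ((y - 1) / (1 + y))\<^sup>2) - 1 / 2 = (1 + y)\<^sup>2 / (2 * (1 + y\<^sup>2)) - 1 / 2" by simp
    also have "\<dots> = y / (1 + y\<^sup>2)"
      using y two by (simp add: divide_simps) (simp add: algebra_simps power2_eq_square)
    finally show "y / (1 + y\<^sup>2) \<in> dress_ring"
      using dress_ring.diff[OF dress_ring.gen half] by metis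
  qed
qed

text \<open>
  A root \<open>a + b \<i>\<close> in the complex numbers has \<open>b \<noteq> 0\<close>, and \<open>l = (X - a)/b\<close> takes the value
  \<open>\<i>\<close> there. The remainder of \<open>g\<close> modulo \<open>1 + l\<^sup>2\<close> is a real polynomial of degree at most one
  that vanishes at this nonreal number, so it is zero. Normalising the factor as \<open>1 + l\<^sup>2\<close> is what
  connects it with the generators of the Dress ring.
\<close>

lemma rootless_quadratic_factor:
  assumes "rootless g" "degree g > 0"
  shows "\<exists>l. degree l = 1 \<and> 1 + l * l dvd g"
proof -
  define ev where "ev z p = poly (map_poly complex_of_real p) z" for z p
  have ev_pCons: "ev z (pCons a p) = of_real a + z * ev z p" for z a p
    by (simp add: ev_def map_poly_pCons)
  have ev_0: "ev z 0 = 0" for z by (simp add: ev_def)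
  have ev_add: "ev z (p + q) = ev z p + ev z q" for z p q
    by (induction p q rule: poly_induct2) (simp_all add: ev_pCons ev_0 algebra_simps)
  have ev_smult: "ev z (smult c p) = of_real c * ev z p" for z c p
    by (induction p) (simp_all add: ev_pCons ev_0 algebra_simps)
  have ev_mult: "ev z (p * q) = ev z p * ev z q" for z p q
    by (induction p) (simp_all add: ev_pCons ev_0 ev_add ev_smult algebra_simps)
  have ev_real: "ev (of_real x) p = of_real (poly p x)" for x p
    by (induction p) (simp_all add: ev_pCons ev_0)
  have "degree (map_poly complex_of_real g) = degree g" by (simp add: degree_map_poly)
  then have "\<not> constant (poly (map_poly complex_of_real g))"
    using assms by (simp add: constant_degree)
  then obtain z where z: "ev z g = 0"
    using fundamental_theorem_of_algebra unfolding ev_def by blast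
  define a b where "a = Re z" and "b = Im z"
  have b: "b \<noteq> 0"
  proof
    assume "b = 0"
    then have "z = of_real a" by (simp add: a_def b_def complex_eq_iff)
    then show False using z assms by (simp add: ev_real rootless_def)
  qed
  define l where "l = [:- a / b, 1 / b:]"
  have "ev z l = \<i>" using b by (simp add: l_def ev_pCons ev_0 a_def b_def complex_eq_iff)
  then have ev_Q: "ev z (1 + l * l) = 0" by (simp add: ev_add ev_mult one_pCons ev_pCons ev_0)
  have deg: "degree l = 1" using b by (simp add: l_def)
  define r where "r = g mod (1 + l * l)"
  have degQ: "degree (1 + l * l) = 2"
    using deg degree_add_mult_self[of 1 l] by simp
  have "r = 0 \<or> degree r < 2"
    using degree_mod_less[of "1 + l * l" g] degQ unfolding r_def by fastforce
  then have "degree r < 2" by auto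
  then have r: "r = [:coeff r 0, coeff r 1:]"
    by (auto simp: poly_eq_iff coeff_pCons coeff_eq_0 split: nat.splits)
  have "g = g div (1 + l * l) * (1 + l * l) + r"
    unfolding r_def by (rule div_mult_mod_eq[symmetric])
  then have "ev z r = 0" using z ev_Q by (metis add_0 ev_add ev_mult mult_zero_right)
  then have "of_real (coeff r 0) + z * of_real (coeff r 1) = 0"
    by (subst (asm) r) (simp add: ev_pCons ev_0)
  then have "coeff r 1 = 0" "coeff r 0 = 0" using b by (auto simp: complex_eq_iff b_def)
  then have "r = 0" using r by simp
  then show ?thesis using deg by (auto simp: r_def mod_eq_0_iff_dvd)
qed

text \<open>
  By induction on the degree of the denominator: split off a factor \<open>1 + l\<^sup>2\<close> with \<open>l\<close> linear and divide
  the numerator by it with remainder. The remainder is a combination of \<open>1\<close> and \<open>l\<close>, and both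
  \<open>1/(1 + l\<^sup>2)\<close> and \<open>l/(1 + l\<^sup>2)\<close> belong to the ring.
\<close>

lemma Fract_in_dress_ring:
  assumes "rootless g" "degree f \<le> degree g"
  shows "Fract f g \<in> dress_ring"
  using assms
proof (induction "degree g" arbitrary: f g rule: less_induct)
  case less
  show ?case
  proof (cases "degree g = 0")
    case True
    then obtain c d where fg: "f = [:c:]" "g = [:d:]" using less.prems(2)
      by (metis degree_eq_zeroE le_zero_eq)
    have "d \<noteq> 0" using less.prems fg by (simp add: rootless_def)
    then have "Fract f g = to_fract [:c / d:]" by (simp add: fg eq_fract to_fract_def)
    then show ?thesis by (simp add: to_fract_const_in_dress_ring)
  next
    case False
    then obtain l h where l: "degree l = 1" and g: "g = (1 + l * l) * h"
      using rootless_quadratic_factor[OF less.prems(1)] by (auto elim!: dvdE)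
    define Q where "Q = 1 + l * l"
    have degQ: "degree Q = 2" using l degree_add_mult_self[of 1 l] by (simp add: Q_def)
    have h: "rootless h" using less.prems(1) by (simp add: g rootless_def)
    have nz: "Q \<noteq> 0" "h \<noteq> 0" using degQ rootless_nonzero[OF h] by auto
    have deg: "degree g = degree h + 2" using nz degQ by (simp add: g degree_mult_eq flip: Q_def)
    define s r where "s = f div Q" and "r = f mod Q"
    have f: "f = s * Q + r" by (simp add: s_def r_def)
    have "degree r < 2"
      using degree_mod_less[of Q f] degQ nz unfolding r_def by fastforce
    then have r: "r = [:coeff r 0, coeff r 1:]"
      by (auto simp: poly_eq_iff coeff_pCons coeff_eq_0 split: nat.splits)
    have "degree (s * Q) \<le> degree g"
    proof -
      have "s * Q = f - r" by (simp add: f)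
      then show ?thesis using less.prems(2) \<open>degree r < 2\<close> deg by (simp add: degree_diff_le)
    qed
    then have degs: "degree s \<le> degree h"
      using degQ nz deg by (cases "s = 0") (simp_all add: degree_mult_eq)
    have eq: "Fract f g = Fract s h + Fract r Q * Fract 1 h"
      using nz by (simp add: eq_fract f g flip: Q_def) (simp add: algebra_simps)
    have IH: "Fract s h \<in> dress_ring" "Fract 1 h \<in> dress_ring"
      using less.hyps[of h] deg h degs by auto
    obtain u v where uv: "r = [:u:] + [:v:] * l"
    proof -
      obtain l0 l1 where l01: "l = [:l0, l1:]" "l1 \<noteq> 0"
      proof
        show "l = [:coeff l 0, coeff l 1:]"
          using l by (auto simp: poly_eq_iff coeff_pCons coeff_eq_0 split: nat.splits)
        show "coeff l 1 \<noteq> 0" using l by (metis degree_0 leading_coeff_0_iff one_neq_zero)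
      qed
      then have "r = [:coeff r 0 - coeff r 1 / l1 * l0:] + [:coeff r 1 / l1:] * l"
        using l01(2) by (subst r) (simp add: l01(1))
      then show ?thesis using that by blast
    qed
    have Q: "to_fract Q = 1 + (to_fract l)\<^sup>2" by (simp add: Q_def power2_eq_square)
    have "Fract r Q = to_fract [:u:] * (1 / (1 + (to_fract l)\<^sup>2)) +
        to_fract [:v:] * (to_fract l / (1 + (to_fract l)\<^sup>2))"
      by (simp only: Fract_conv_to_fract uv Q to_fract_add to_fract_mult) (simp add: add_divide_distrib)
    then have "Fract r Q \<in> dress_ring"
      by (simp only:) (intro dress.closed_in dress_ring.gen to_fract_const_in_dress_ring
        divide_1_plus_square_in_dress_ring)
    then show ?thesis unfolding eq by (intro dress.add_in dress.mult_in IH)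
  qed
qed

lemma divide_in_dress_ring:
  "rootless g \<Longrightarrow> degree f \<le> degree g \<Longrightarrow> to_fract f / to_fract g \<in> dress_ring"
  unfolding Fract_conv_to_fract[symmetric] by (rule Fract_in_dress_ring)

section \<open>A rootless combination of two polynomials of odd degree\<close>

text \<open>
  The set where \<open>v \<le> 0\<close> is compact and \<open>u\<close> has a positive lower bound on it, so a large multiple
  of \<open>u\<close> compensates the values of \<open>v\<close> there.
\<close>

lemma positive_on_ray:
  fixes u v :: "real \<Rightarrow> real"
  assumes cont: "continuous_on {a..} u" "continuous_on {a..} v"
    and u: "\<And>x. x \<ge> a \<Longrightarrow> u x \<ge> 0"
    and v: "\<And>x. x \<ge> a \<Longrightarrow> u x = 0 \<Longrightarrow> v x > 0" "eventually (\<lambda>x. v x > 0) at_top"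
  shows "\<exists>K\<ge>0. \<forall>x\<ge>a. v x + K * u x > 0"
proof -
  obtain b where b: "\<And>x. x \<ge> b \<Longrightarrow> v x > 0"
    using v(2) by (auto simp: eventually_at_top_linorder)
  \<comment> \<open>Beyond \<open>b\<close> the function \<open>v\<close> is positive, so \<open>T\<close> contains every point of the ray with \<open>v \<le> 0\<close>.\<close>
  define T where "T = {x \<in> {a..b}. v x \<le> 0}"
  have contT: "continuous_on {a..b} u" "continuous_on {a..b} v"
    using cont by (auto intro: continuous_on_subset)
  have "closed T" unfolding T_def
    by (intro continuous_on_closed_Collect_le contT continuous_intros closed_atLeastAtMost)
  then have T: "compact T"
    unfolding T_def by (intro compact_eq_bounded_closed[THEN iffD2] conjI) (auto intro: bounded_subset[OF bounded_closed_interval])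
  have outside: "v x > 0" if "x \<ge> a" "x \<notin> T" for x
    using that b[of x] by (cases "x \<le> b") (auto simp: T_def)
  show ?thesis
  proof (cases "T = {}")
    case True
    then show ?thesis using outside by (intro exI[of _ 0]) auto
  next
    case False
    have "T \<subseteq> {a..b}" by (auto simp: T_def)
    then have contT': "continuous_on T u" "continuous_on T v"
      using contT continuous_on_subset by blast+
    obtain y where y: "y \<in> T" "\<And>x. x \<in> T \<Longrightarrow> u y \<le> u x"
      using continuous_attains_inf[OF T False contT'(1)] by blast
    obtain z where z: "z \<in> T" "\<And>x. x \<in> T \<Longrightarrow> v z \<le> v x"
      using continuous_attains_inf[OF T False contT'(2)] by blast
    have uy: "u y > 0" using y(1) u[of y] v(1)[of y] by (force simp: T_def)
    have vz: "v z \<le> 0" using z(1) by (simp add: T_def)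
    define K where "K = (1 - v z) / u y"
    have K: "K \<ge> 0" using uy vz by (simp add: K_def)
    have "v x + K * u x > 0" if "x \<ge> a" for x
    proof (cases "x \<in> T")
      case True
      have "K * u x \<ge> K * u y" using K y(2)[OF True] by (intro mult_left_mono)
      moreover have "K * u y = 1 - v z" using uy by (simp add: K_def)
      ultimately show ?thesis using z(2)[OF True] by linarith
    next
      case False
      then show ?thesis using outside[OF that] K u[OF that] by (simp add: add_pos_nonneg)
    qed
    then show ?thesis using K by blast
  qed
qed

text \<open>
  With \<open>p = f/(1 + X\<^sup>2)\<^sup>n\<close> and \<open>q = h/(1 + X\<^sup>2)\<^sup>n\<close>, this is the numerator of
  \<open>p + L (1 + X\<^sup>2) (q - C p)\<^sup>2\<close> over the denominator \<open>(1 + X\<^sup>2)\<^bsup>2n\<^esup>\<close>. It represents a unit of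
  the Dress ring if it has no real root and the degree \<open>4n\<close> of the denominator.
\<close>

definition perturbed :: "real poly \<Rightarrow> real poly \<Rightarrow> nat \<Rightarrow> real \<Rightarrow> real \<Rightarrow> real poly" where
  "perturbed f h n C L = f * X2_plus_1 ^ n + smult L (X2_plus_1 * (h - smult C f)\<^sup>2)"

text \<open>
  On the ray to the right of \<open>a\<close> the polynomial \<open>f\<close> is nonnegative and \<open>h\<close> is positive both at \<open>a\<close>,
  the only zero of \<open>f\<close> there, and near infinity. So \<open>h + K f\<close> is positive on that ray for large \<open>K\<close>,
  and a large multiple of \<open>(1 + X\<^sup>2) (h + K f)\<^sup>2\<close>, which also has the larger degree, dominates
  \<open>f (1 + X\<^sup>2)\<^sup>n\<close>. Subtracting that multiple gives negative values on the ray, and on the other side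
  of \<open>a\<close> both summands are nonpositive and \<open>f\<close> is negative.
\<close>

lemma perturbed_rootless_right:
  assumes f: "\<And>x. x > a \<Longrightarrow> poly f x > 0" "poly f a = 0" "\<And>x. x < a \<Longrightarrow> poly f x < 0"
    and h: "poly h a > 0" "lead_coeff h > 0"
    and deg: "degree f \<le> degree h" "degree h + 1 = 2 * n"
  shows "\<exists>C L. rootless (perturbed f h n C L) \<and> degree (perturbed f h n C L) = 4 * n"
proof -
  obtain K where K: "K \<ge> 0" "\<And>x. x \<ge> a \<Longrightarrow> poly h x + K * poly f x > 0"
  proof -
    have "\<exists>K\<ge>0. \<forall>x\<ge>a. poly h x + K * poly f x > 0"
    proof (rule positive_on_ray)
      fix x assume "x \<ge> a"
      then show "poly f x \<ge> 0" using f by (cases "x = a") (auto simp: less_imp_le)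
      show "poly h x > 0" if "poly f x = 0"
        using that \<open>x \<ge> a\<close> f(1)[of x] h(1) by (cases "x = a") auto
    qed (use h eventually_poly_pos in \<open>auto intro!: continuous_intros\<close>)
    then show ?thesis using that by blast
  qed
  define H where "H = h + smult K f"
  have "eventually (\<lambda>x. poly f x \<ge> 0) at_top"
    using eventually_gt_at_top[of a] by eventually_elim (use f(1) in \<open>auto simp: less_imp_le\<close>)
  then have "lead_coeff f \<ge> 0" by (rule lead_coeff_nonneg)
  then have "coeff f (degree h) \<ge> 0"
    using deg(1) by (cases "degree f = degree h") (auto simp: coeff_eq_0)
  then have cH: "coeff H (degree h) > 0" using K(1) h(2) by (simp add: H_def add_pos_nonneg)
  have "degree H \<le> degree h" unfolding H_def using deg by (intro degree_add_le) auto
  then have degH: "degree H = degree h" using le_degree[of H "degree h"] cH by simp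
  have degH2: "degree (X2_plus_1 * H\<^sup>2) = 4 * n"
    using deg(2) by (intro degree_X2_plus_1_mult_square) (simp only: degH)
  have degf: "degree (f * X2_plus_1 ^ n) < 4 * n" using deg by (intro degree_mult_X2_plus_1_power) simp
  have leadH2: "lead_coeff (X2_plus_1 * H\<^sup>2) > 0"
  proof -
    have "lead_coeff (X2_plus_1 * H\<^sup>2) = (lead_coeff H)\<^sup>2"
      by (simp only: lead_coeff_mult lead_coeff_X2_plus_1 lead_coeff_power mult_1)
    then show ?thesis using cH by (simp add: degH)
  qed
  define V where "V = X2_plus_1 * H\<^sup>2 + - (f * X2_plus_1 ^ n)"
  have "lead_coeff V = lead_coeff (X2_plus_1 * H\<^sup>2)"
    unfolding V_def using degf degH2 by (metis add.commute degree_minus lead_coeff_add_le)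
  then have leadV: "lead_coeff V > 0" using leadH2 by simp
  have "\<exists>L\<ge>0. \<forall>x\<ge>a. poly V x + L * poly (X2_plus_1 * H\<^sup>2) x > 0"
  proof (rule positive_on_ray)
    fix x assume "x \<ge> a"
    then have "poly H x > 0" using K(2) by (simp add: H_def)
    then have pos: "poly (X2_plus_1 * H\<^sup>2) x > 0" using poly_X2_plus_1_pos[of x] by (simp add: poly_power)
    show "poly V x > 0" if "poly (X2_plus_1 * H\<^sup>2) x = 0"
      using that pos by linarith
    show "poly (X2_plus_1 * H\<^sup>2) x \<ge> 0" using pos by (rule less_imp_le)
  qed (use leadV eventually_poly_pos in \<open>auto intro!: continuous_intros\<close>)
  then obtain L where L: "L \<ge> 0" "\<And>x. x \<ge> a \<Longrightarrow> poly V x + L * poly (X2_plus_1 * H\<^sup>2) x > 0" by blast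
  define F where "F = perturbed f h n (- K) (- (1 + L))"
  have F: "F = f * X2_plus_1 ^ n + smult (- (1 + L)) (X2_plus_1 * H\<^sup>2)"
    by (simp add: F_def perturbed_def H_def)
  have "degree F = 4 * n"
    unfolding F using L(1) degf degH2 by (subst degree_add_eq_right) auto
  moreover have "poly F x < 0" for x
  proof (cases "x \<ge> a")
    case True
    then show ?thesis using L(2)[OF True] by (simp add: F V_def algebra_simps)
  next
    case False
    then have "poly f x < 0" using f(3) by simp
    then have "poly (f * X2_plus_1 ^ n) x < 0" using poly_X2_plus_1_pos[of x] by (simp add: mult_neg_pos poly_power)
    moreover have "(1 + L) * poly (X2_plus_1 * H\<^sup>2) x \<ge> 0"
      using L(1) poly_X2_plus_1_pos[of x] by (simp add: poly_power less_imp_le)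
    moreover have "poly F x = poly (f * X2_plus_1 ^ n) x - (1 + L) * poly (X2_plus_1 * H\<^sup>2) x"
      by (simp add: F algebra_simps)
    ultimately show ?thesis by linarith
  qed
  ultimately show ?thesis unfolding F_def rootless_def by (metis less_irrefl)
qed

text \<open>
  The signs of \<open>f\<close> and \<open>h\<close> can be reversed at the cost of sign changes of \<open>C\<close> and \<open>L\<close>, and
  \<open>X\<close> may be replaced by \<open>- X\<close>. As both degrees are odd, these symmetries lead to the signs
  required by \<open>perturbed_rootless_right\<close>: \<open>f\<close> and \<open>h\<close> are made positive near plus infinity, and
  if \<open>h\<close> is then negative at \<open>a\<close>, reflecting and changing both signs makes it positive at \<open>- a\<close>
  without altering the signs near plus infinity.
\<close>

lemma perturbed_rootless_ex:
  assumes f: "odd (degree f)" "\<And>x. poly f x = 0 \<longleftrightarrow> x = a"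
    and h: "poly h a \<noteq> 0"
    and deg: "degree f \<le> degree h" "degree h + 1 = 2 * n"
  shows "\<exists>C L. rootless (perturbed f h n C L) \<and> degree (perturbed f h n C L) = 4 * n"
proof -
  define good where "good f h \<longleftrightarrow>
    (\<exists>C L. rootless (perturbed f h n C L) \<and> degree (perturbed f h n C L) = 4 * n)" for f h
  have neg_f: "good f h" if "good (- f) h" for f h
  proof -
    have "perturbed (- f) h n C L = - perturbed f h n (- C) (- L)" for C L
      by (simp add: perturbed_def)
    then show ?thesis using that by (auto simp: good_def rootless_def)
  qed
  have neg_h: "good f h" if "good f (- h)" for f h
  proof -
    have "perturbed f (- h) n C L = perturbed f h n (- C) L" for C L
      by (simp add: perturbed_def power2_eq_square algebra_simps)
    then show ?thesis using that unfolding good_def by metis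
  qed
  have reflect: "good f h" if "good (f \<circ>\<^sub>p [:0, -1:]) (h \<circ>\<^sub>p [:0, -1:])" for f h
  proof -
    have X2_plus_1: "X2_plus_1 \<circ>\<^sub>p [:0, -1:] = X2_plus_1" by (simp add: X2_plus_1_def pcompose_pCons)
    then have X2_plus_1_n: "(X2_plus_1 ^ n) \<circ>\<^sub>p [:0, -1:] = X2_plus_1 ^ n"
      by (induction n) (simp_all add: pcompose_mult pcompose_1)
    have e: "perturbed (f \<circ>\<^sub>p [:0, -1:]) (h \<circ>\<^sub>p [:0, -1:]) n C L = perturbed f h n C L \<circ>\<^sub>p [:0, -1:]" for C L
      by (simp add: perturbed_def pcompose_add pcompose_mult pcompose_smult pcompose_diff
          X2_plus_1 X2_plus_1_n power2_eq_square)
    have r: "rootless p" if "rootless (p \<circ>\<^sub>p [:0, -1:])" for p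
      unfolding rootless_def
    proof
      fix x show "poly p x \<noteq> 0" using that[unfolded rootless_def, rule_format, of "- x"] by (simp add: poly_pcompose)
    qed
    from that obtain C L where "rootless (perturbed f h n C L \<circ>\<^sub>p [:0, -1:])"
      "degree (perturbed f h n C L \<circ>\<^sub>p [:0, -1:]) = 4 * n"
      unfolding good_def e by blast
    then have "rootless (perturbed f h n C L)" "degree (perturbed f h n C L) = 4 * n"
      using r by (auto simp: degree_pcompose)
    then show ?thesis unfolding good_def by blast
  qed
  have pos: "good f h" if "odd (degree f)" "\<And>x. poly f x = 0 \<longleftrightarrow> x = a" "poly h a > 0"
     "lead_coeff f > 0" "lead_coeff h > 0" "degree f \<le> degree h" "degree h + 1 = 2 * n" for f h a
    unfolding good_def
    by (rule perturbed_rootless_right[of a])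
       (use that unique_root_sign_right[of f a] unique_root_sign_left[of f a] in blast)+
  have lead: "good f h" if *: "odd (degree f)" "\<And>x. poly f x = 0 \<longleftrightarrow> x = a" "poly h a \<noteq> 0"
     "lead_coeff f > 0" "lead_coeff h > 0" "degree f \<le> degree h" "degree h + 1 = 2 * n" for f h
  proof (cases "poly h a > 0")
    case True
    show ?thesis by (rule pos[OF *(1,2) True *(4-7)])
  next
    case False
    have odd: "odd (degree h)" using that(7) by presburger
    let ?f = "- (f \<circ>\<^sub>p [:0, -1:])" and ?h = "- (h \<circ>\<^sub>p [:0, -1:])"
    have "good ?f ?h"
    proof (rule pos[of _ "- a"])
      show "poly ?f x = 0 \<longleftrightarrow> x = - a" for x using *(2)[of "- x"] by (auto simp: poly_pcompose)
      show "lead_coeff ?f > 0" using *(1,4) by (simp only: lead_coeff_minus lead_coeff_reflect) simp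
      show "lead_coeff ?h > 0" using odd *(5) by (simp only: lead_coeff_minus lead_coeff_reflect) simp
      show "odd (degree ?f)" using *(1) by (simp add: degree_pcompose)
      show "poly ?h (- a) > 0" using False *(3) by (simp add: poly_pcompose)
      show "degree ?f \<le> degree ?h" "degree ?h + 1 = 2 * n" using *(6,7) by (simp_all add: degree_pcompose)
    qed
    then have "good ?f (h \<circ>\<^sub>p [:0, -1:])" by (rule neg_h)
    then have "good (f \<circ>\<^sub>p [:0, -1:]) (h \<circ>\<^sub>p [:0, -1:])" by (rule neg_f)
    then show ?thesis by (rule reflect)
  qed
  have leadf: "good f h" if *: "odd (degree f)" "\<And>x. poly f x = 0 \<longleftrightarrow> x = a" "poly h a \<noteq> 0"
     "lead_coeff f > 0" "degree f \<le> degree h" "degree h + 1 = 2 * n" for f h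
  proof -
    have "lead_coeff h \<noteq> 0"
    proof
      assume "lead_coeff h = 0"
      then have "degree h = 0" by simp
      then show False using *(6) by presburger
    qed
    then consider "lead_coeff h > 0" | "lead_coeff (- h) > 0" by fastforce
    then show ?thesis
    proof cases
      case 1
      show ?thesis by (rule lead[OF *(1,2,3,4) 1 *(5,6)])
    next
      case 2
      have "good f (- h)" by (rule lead[OF *(1,2) _ *(4) 2]) (use *(3,5,6) in simp_all)
      then show ?thesis by (rule neg_h)
    qed
  qed
  have "lead_coeff f \<noteq> 0" using f(1) by (metis degree_0 even_zero leading_coeff_0_iff)
  then consider "lead_coeff f > 0" | "lead_coeff (- f) > 0" by fastforce
  then have "good f h"
  proof cases
    case 1
    show ?thesis by (rule leadf[OF f h 1 deg])
  next
    case 2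
    have "good (- f) h" by (rule leadf[OF _ _ h 2 _ deg(2)]) (use f deg in simp_all)
    then show ?thesis by (rule neg_f)
  qed
  then show ?thesis by (simp add: good_def)
qed

section \<open>Rows without a common real zero\<close>

text \<open>
  Both summands of \<open>p + e q\<^sup>2\<close> have the sign \<open>e\<close> and they have no common zero on the
  projective line, infinity included: one of the two degrees is maximal. So this sum is a unit.
\<close>

lemma row_factors_no_sign_change:
  assumes deg: "degree f \<le> 2 * n" "degree h \<le> 2 * n" "degree f = 2 * n \<or> degree h = 2 * n"
    and nz: "f \<noteq> 0" "h \<noteq> 0"
    and e: "e = 1 \<or> e = - 1" and sign: "\<And>x. e * poly f x \<ge> 0"
    and common: "\<And>x. poly f x = 0 \<Longrightarrow> poly h x \<noteq> 0"
  shows "dress.row_factors (to_fract f / to_fract (X2_plus_1 ^ n))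
    (to_fract h / to_fract (X2_plus_1 ^ n))"
proof -
  define S where "S = X2_plus_1 ^ n"
  have S: "rootless S" "degree S = 2 * n" "S \<noteq> 0" "coeff S (2 * n) = 1"
  proof -
    show "rootless S" "degree S = 2 * n" "S \<noteq> 0"
      using rootless_power[OF rootless_X2_plus_1] X2_plus_1_nonzero by (simp_all add: S_def degree_power_eq degree_X2_plus_1)
    then show "coeff S (2 * n) = 1"
      by (metis S_def lead_coeff_power lead_coeff_X2_plus_1 power_one)
  qed
  define G where "G = f * S + smult e (h * h)"
  have eG: "e * poly G x = e * poly f x * poly S x + (poly h x)\<^sup>2" for x
    using e by (auto simp: G_def power2_eq_square)
  have "e * poly G x > 0" for x
  proof (cases "poly f x = 0")
    case True
    then show ?thesis using common[OF True] by (simp add: eG)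
  next
    case False
    then have "e * poly f x > 0" using sign[of x] e by (auto simp: less_le)
    then show ?thesis using poly_X2_plus_1_pos[of x] by (simp add: eG S_def poly_power add_pos_nonneg)
  qed
  then have rG: "rootless G" unfolding rootless_def by (metis less_irrefl mult_zero_right)
  have "e * coeff f (2 * n) \<ge> 0"
  proof -
    have "lead_coeff (smult e f) \<ge> 0" by (rule lead_coeff_nonneg) (simp add: sign)
    then show ?thesis using e deg(1) by (cases "degree f = 2 * n") (auto simp: coeff_eq_0)
  qed
  moreover have "coeff f (2 * n) \<noteq> 0 \<or> coeff h (2 * n) \<noteq> 0"
    using deg(3) nz by (metis leading_coeff_0_iff)
  ultimately have "e * coeff f (2 * n) > 0 \<and> (coeff h (2 * n))\<^sup>2 \<ge> 0 \<or>
      e * coeff f (2 * n) \<ge> 0 \<and> (coeff h (2 * n))\<^sup>2 > 0"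
    using e by (auto simp: less_le)
  then have "e * coeff f (2 * n) + (coeff h (2 * n))\<^sup>2 > 0" by linarith
  also have "e * coeff f (2 * n) + (coeff h (2 * n))\<^sup>2 = e * coeff G (2 * n + 2 * n)"
    using e coeff_mult_le[of f "2 * n" S "2 * n"] coeff_mult_le[of h "2 * n" h "2 * n"] deg S
    by (auto simp: G_def power2_eq_square)
  finally have "degree G \<ge> 2 * n + 2 * n" by (intro le_degree) auto
  moreover have "degree G \<le> 2 * n + 2 * n" unfolding G_def
    using deg S degree_mult_le[of f S] degree_mult_le[of h h]
    by (intro degree_add_le order.trans[OF degree_smult_le]) auto
  ultimately have dG: "degree G = degree (S * S)" using S by (simp add: degree_mult_eq)
  have S': "to_fract S \<noteq> 0" using S by simp
  have rS: "rootless (S * S)" using S rootless_mult by blast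
  have eq: "to_fract f / to_fract S + to_fract (smult e h) / to_fract S * (to_fract h / to_fract S) =
      to_fract G / to_fract (S * S)"
    using S' by (simp add: G_def field_simps flip: to_fract_mult to_fract_add)
  show ?thesis unfolding S_def[symmetric]
  proof (rule dress.row_factors_combination_unit)
    show "to_fract h / to_fract S \<in> dress_ring" "to_fract (smult e h) / to_fract S \<in> dress_ring"
      using S deg degree_smult_le[of e h] by (auto intro!: divide_in_dress_ring)
    show "to_fract f / to_fract S + to_fract (smult e h) / to_fract S * (to_fract h / to_fract S) \<in> dress_ring"
      unfolding eq using rS dG by (intro divide_in_dress_ring) auto
    show "to_fract (S * S) / to_fract G \<in> dress_ring"
      using rG dG by (intro divide_in_dress_ring) auto
    show "(to_fract f / to_fract S + to_fract (smult e h) / to_fract S * (to_fract h / to_fract S)) *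
        (to_fract (S * S) / to_fract G) = 1"
      unfolding eq using rootless_nonzero[OF rG] rootless_nonzero[OF rS] by simp
  qed
qed

text \<open>
  The entry \<open>q = h/(1 + X\<^sup>2)\<^sup>n\<close> has a simple zero at infinity and \<open>p\<close> vanishes there too, so
  no combination of \<open>p\<close> and \<open>q\<close> is a unit. Take \<open>C\<close> and \<open>L\<close> from \<open>perturbed_rootless_ex\<close> and project onto the line
  of the vector \<open>(p + C q, q - C p)\<close>. Its product with the row is \<open>p\<^sup>2 + q\<^sup>2\<close>, whose only
  zero on the projective line is a double one at infinity; each entry of the vector times
  \<open>p\<close> or \<open>q\<close> vanishes there at least doubly too, so the projection has entries in the Dress ring.
  The new first entry is the unit \<open>p + L (1 + X\<^sup>2) (q - C p)\<^sup>2\<close>.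
\<close>

lemma row_factors_simple_zero_at_infinity:
  assumes f: "odd (degree f)" "\<And>x. poly f x = 0 \<longleftrightarrow> x = a"
    and h: "poly h a \<noteq> 0"
    and deg: "degree f \<le> degree h" "degree h + 1 = 2 * n"
  shows "dress.row_factors (to_fract f / to_fract (X2_plus_1 ^ n))
    (to_fract h / to_fract (X2_plus_1 ^ n))"
proof -
  define S where "S = X2_plus_1 ^ n"
  have S: "rootless S" "degree S = 2 * n" "S \<noteq> 0"
    using rootless_power[OF rootless_X2_plus_1] X2_plus_1_nonzero by (simp_all add: S_def degree_power_eq degree_X2_plus_1)
  have rSS: "rootless (S * S)" and dSS: "degree (S * S) = 4 * n"
    using S rootless_mult by (auto simp: degree_mult_eq)
  obtain C L where F: "rootless (perturbed f h n C L)" "degree (perturbed f h n C L) = 4 * n"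
    using perturbed_rootless_ex[OF f h deg] by blast
  define F where "F = perturbed f h n C L"
  define v1 v2 w where "v1 = f + smult C h" and "v2 = h - smult C f" and "w = f * f + h * h"
  define K where "K = smult L (X2_plus_1 * v2)"
  define F' where "F' = h * S - K * v1"
  have w: "rootless w" using f h by (auto simp: w_def rootless_def sum_squares_eq_zero_iff)
  have dw: "degree w = 2 * degree h" using deg by (simp add: w_def degree_add_mult_self max_def)
  have dv: "degree v1 \<le> degree h" "degree v2 \<le> degree h"
    unfolding v1_def v2_def using deg degree_smult_le[of C h] degree_smult_le[of C f]
    by (auto intro!: degree_add_le degree_diff_le)
  let ?p = "to_fract f / to_fract S" and ?q = "to_fract h / to_fract S"
  \<comment> \<open>The vector \<open>(V, W)\<close> is \<open>(p + C q, q - C p)/(p\<^sup>2 + q\<^sup>2)\<close>, and \<open>T\<close> is chosen such that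
    \<open>T W = L (1 + X\<^sup>2) (q - C p)\<^sup>2\<close>.\<close>
  define V W T where "V = to_fract (v1 * S) / to_fract w" and "W = to_fract (v2 * S) / to_fract w"
    and "T = to_fract (K * w) / to_fract (S * S * S)"
  have S': "to_fract S \<noteq> 0" and w': "to_fract w \<noteq> 0" using S rootless_nonzero[OF w] by auto
  have entry: "to_fract x / to_fract S * (to_fract (y * S) / to_fract w) \<in> dress_ring"
    if "degree x \<le> degree h" "degree y \<le> degree h" for x y
  proof -
    have "to_fract (x * y) / to_fract w \<in> dress_ring"
      using w dw that degree_mult_le[of x y] by (intro divide_in_dress_ring) auto
    then show ?thesis using S' by simp
  qed
  have T: "T * (to_fract (v * S) / to_fract w) = to_fract (K * v) / to_fract (S * S)" for v
    using S' w' by (simp add: T_def field_simps)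
  have F_eq: "F = f * S + K * v2"
    by (simp add: F_def perturbed_def S_def K_def v2_def power2_eq_square mult.assoc)
  have "?p + T * W = to_fract f / to_fract S + to_fract (K * v2) / to_fract (S * S)"
    by (simp only: W_def T)
  also have "\<dots> = to_fract F / to_fract (S * S)" using S' by (simp add: F_eq field_simps)
  finally have eF: "?p + T * W = to_fract F / to_fract (S * S)" .
  have "?q - T * V = to_fract h / to_fract S - to_fract (K * v1) / to_fract (S * S)"
    by (simp only: V_def T)
  also have "\<dots> = to_fract F' / to_fract (S * S)" using S' by (simp add: F'_def field_simps)
  finally have eF': "?q - T * V = to_fract F' / to_fract (S * S)" .
  show ?thesis unfolding S_def[symmetric]
  proof (rule dress.row_factors_projection)
    have "f * v1 + h * v2 = w" by (simp add: v1_def v2_def w_def algebra_simps)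
    then have "to_fract f * to_fract v1 + to_fract h * to_fract v2 = to_fract w"
      by (simp flip: to_fract_mult to_fract_add)
    then show "?p * V + ?q * W = 1" using S' w' by (simp add: V_def W_def flip: add_divide_distrib)
    show "?p * V \<in> dress_ring" "?q * V \<in> dress_ring" "?p * W \<in> dress_ring" "?q * W \<in> dress_ring"
      unfolding V_def W_def using dv deg by (intro entry; simp)+
    show "dress.row_factors (?p + T * W) (?q - T * V)"
      unfolding eF eF'
    proof (rule dress.row_factors_unit)
      show "to_fract F / to_fract (S * S) \<in> dress_ring" "to_fract (S * S) / to_fract F \<in> dress_ring"
        using F rSS dSS by (auto simp: F_def simp del: to_fract_mult intro!: divide_in_dress_ring)
      show "to_fract F / to_fract (S * S) * (to_fract (S * S) / to_fract F) = 1"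
        using rootless_nonzero[OF F(1)] rootless_nonzero[OF rSS] by (simp add: F_def)
      have "degree (h * S) \<le> 4 * n" using degree_mult_le[of h S] deg S by simp
      moreover have "degree (K * v1) \<le> 4 * n"
        using degree_mult_le[of K v1] degree_smult_le[of L "X2_plus_1 * v2"]
          degree_mult_le[of X2_plus_1 v2] dv deg by (simp add: K_def degree_X2_plus_1)
      ultimately have "degree F' \<le> 4 * n" unfolding F'_def by (rule degree_diff_le)
      then show "to_fract F' / to_fract (S * S) \<in> dress_ring" using rSS dSS
        by (intro divide_in_dress_ring) auto
    qed
  qed
qed

section \<open>Rows with entries of odd degree\<close>

text \<open>
  The common factor of the row is \<open>(X - a)\<^sup>m (1 + X\<^sup>2)\<^sup>n/g\<close>, where \<open>m\<close> is the smaller of the two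
  orders at \<open>a\<close> and \<open>n\<close> is least possible such that the remaining entries lie in the Dress ring. The parity of
  \<open>m\<close> decides which of the two preceding lemmas applies to the remaining row. Parity also guarantees that the
  factor itself lies in the ring: \<open>deg g\<close> is even and the degrees of \<open>f\<close> and \<open>h\<close> are odd, so both
  are strictly smaller than \<open>deg g\<close>.
\<close>

lemma row_factors_odd_degrees:
  assumes g: "rootless g"
    and f: "odd (degree f)" "degree f \<le> degree g" "\<And>x. poly f x = 0 \<longleftrightarrow> x = a"
    and h: "odd (degree h)" "degree h \<le> degree g"
  shows "dress.row_factors (to_fract f / to_fract g) (to_fract h / to_fract g)"
proof -
  have nz: "f \<noteq> 0" "h \<noteq> 0" using f(1) h(1) by auto
  have g_even: "even (degree g)" by (rule rootless_even_degree[OF g])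
  then have deg_g: "degree f + 1 \<le> degree g" "degree h + 1 \<le> degree g"
    using f h by (metis Suc_eq_plus1 Suc_leI le_neq_implies_less)+
  define X where "X = [:- a, 1:]"
  define m where "m = min (order a f) (order a h)"
  have "X ^ m dvd f" "X ^ m dvd h"
    unfolding X_def m_def by (meson dvd_trans le_imp_power_dvd min.cobounded1 min.cobounded2 order_1)+
  then obtain f1 h1 where f1: "f = X ^ m * f1" and h1: "h = X ^ m * h1" by (elim dvdE)
  have nz1: "f1 \<noteq> 0" "h1 \<noteq> 0" using nz f1 h1 by auto
  have degX: "degree (X ^ m) = m" by (simp add: X_def degree_linear_power)
  have "X ^ m \<noteq> 0" by (simp add: X_def)
  then have deg1: "degree f = m + degree f1" "degree h = m + degree h1"
    using nz1 degX by (simp_all add: f1 h1 degree_mult_eq)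
  have not_both: "poly f1 a \<noteq> 0 \<or> poly h1 a \<noteq> 0"
  proof (rule ccontr)
    assume "\<not> ?thesis"
    then have "X dvd f1" "X dvd h1" by (auto simp: X_def poly_eq_0_iff_dvd)
    then have "X ^ Suc m dvd f" "X ^ Suc m dvd h"
      unfolding f1 h1 power_Suc2 by (auto intro: mult_dvd_mono)
    then have "Suc m \<le> order a f" "Suc m \<le> order a h"
      using nz by (auto simp: X_def order_divides simp del: power_Suc)
    then show False by (simp add: m_def)
  qed
  have root_f1: "x = a" if "poly f1 x = 0" for x
    using that f(3)[of x] by (simp add: f1)
  have reduce: "dress.row_factors (to_fract f / to_fract g) (to_fract h / to_fract g)"
    if "dress.row_factors (to_fract f1 / to_fract (X2_plus_1 ^ n)) (to_fract h1 / to_fract (X2_plus_1 ^ n))"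
      and "m + 2 * n \<le> degree g" for n
  proof -
    have d: "to_fract (X ^ m * X2_plus_1 ^ n) / to_fract g \<in> dress_ring"
    proof (rule divide_in_dress_ring[OF g])
      show "degree (X ^ m * X2_plus_1 ^ n) \<le> degree g"
        using degree_mult_le[of "X ^ m" "X2_plus_1 ^ n"] degX that(2) X2_plus_1_nonzero
        by (simp add: degree_power_eq degree_X2_plus_1)
    qed
    have e: "to_fract (X ^ m * X2_plus_1 ^ n) / to_fract g * (to_fract z / to_fract (X2_plus_1 ^ n)) =
        to_fract (X ^ m * z) / to_fract g" for z
      using X2_plus_1_nonzero by simp
    show ?thesis using dress.row_factors_scale[OF that(1) d] unfolding e f1 h1 .
  qed
  show ?thesis
  proof (cases "even m")
    case True
    have odd1: "odd (degree f1)" "odd (degree h1)" using True f(1) h(1) deg1 by auto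
    \<comment> \<open>The odd degree of \<open>f1\<close> forces a root; so \<open>h\<close> has the smaller order at \<open>a\<close>.\<close>
    obtain y where "poly f1 y = 0" using odd_degree_imp_root[OF odd1(1)] by blast
    then have f1_root: "poly f1 x = 0 \<longleftrightarrow> x = a" for x using root_f1 by metis
    then have h1_a: "poly h1 a \<noteq> 0" using not_both by blast
    show ?thesis
    proof (cases "degree f1 \<le> degree h1")
      case le: True
      have "even (degree h1 + 1)" using odd1 by simp
      then obtain n where n: "degree h1 + 1 = 2 * n" by (elim evenE)
      show ?thesis
        by (rule reduce[OF row_factors_simple_zero_at_infinity[OF odd1(1) f1_root h1_a le n]])
           (use n deg1 deg_g in simp)
    next
      case False
      have "even (degree f1 + 1)" using odd1 by simp
      then obtain n where n: "degree f1 + 1 = 2 * n" by (elim evenE)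
      \<comment> \<open>Here only \<open>f1\<close> attains the larger degree; adding it to \<open>h1\<close> gives both entries that degree
        and keeps the value at \<open>a\<close>.\<close>
      have d: "degree (h1 + f1) = degree f1" using False by (intro degree_add_eq_right) simp
      have "dress.row_factors (to_fract f1 / to_fract (X2_plus_1 ^ n)) (to_fract (h1 + f1) / to_fract (X2_plus_1 ^ n))"
        using h1_a n
        by (intro row_factors_simple_zero_at_infinity[OF odd1(1) f1_root])
           (simp_all add: d f1_root[THEN iffD2])
      from dress.row_factors_add_multiple[OF this, of "- 1"]
      have "dress.row_factors (to_fract f1 / to_fract (X2_plus_1 ^ n)) (to_fract h1 / to_fract (X2_plus_1 ^ n))"
        by (simp add: dress.closed_in add_divide_distrib)
      then show ?thesis by (rule reduce) (use n deg1 deg_g in simp)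
    qed
  next
    case False
    have even1: "even (degree f1)" "even (degree h1)" using False f(1) h(1) deg1 by auto
    define M where "M = max (degree f1) (degree h1)"
    have "even M" using even1 by (simp add: M_def max_def)
    then obtain n where n: "M = 2 * n" by (elim evenE)
    define e :: real where "e = (if lead_coeff f > 0 then 1 else - 1)"
    have e: "e = 1 \<or> e = - 1" by (simp add: e_def)
    have "lead_coeff f > 0 \<or> lead_coeff f < 0" using nz(1) leading_coeff_0_iff[of f] by linarith
    then have "e * lead_coeff f > 0" by (auto simp: e_def)
    then have lead: "lead_coeff (smult e f) > 0" by (simp only: lead_coeff_smult)
    have root: "x = a" if "poly (smult e f) x = 0" for x
    proof -
      have "poly f x = 0" using that e by auto
      then show ?thesis using f(3) by blast
    qed
    have f_eq: "poly f x = (x - a) ^ m * poly f1 x" for x by (simp add: f1 X_def poly_power)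
    have off_a: "e * poly f1 x > 0" if "x \<noteq> a" for x
    proof (cases "x > a")
      case True
      then have "(x - a) ^ m * (e * poly f1 x) > 0"
        using unique_root_sign_right[OF lead root True] by (simp add: f_eq algebra_simps)
      then show ?thesis using True by (simp add: zero_less_mult_iff)
    next
      case less: False
      then have x: "x < a" using that by simp
      have "odd (degree (smult e f))" using e f(1) by auto
      from unique_root_sign_left[OF lead this root x]
      have "(x - a) ^ m * (e * poly f1 x) < 0" by (simp add: f_eq algebra_simps)
      moreover have "(x - a) ^ m < 0" using False x by (simp add: power_less_zero_eq)
      ultimately show ?thesis by (simp add: mult_less_0_iff)
    qed
    have sign: "e * poly f1 x \<ge> 0" for x
    proof (cases "x = a")
      case True
      show ?thesis
      proof (rule ccontr)
        assume "\<not> ?thesis"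
        then have "poly (smult e f1) a < 0" using True by simp
        moreover have "poly (smult e f1) (a + 1) > 0" using off_a[of "a + 1"] by simp
        ultimately obtain y where "y > a" "poly (smult e f1) y = 0"
          using poly_IVT_pos[of a "a + 1" "smult e f1"] by auto
        then have "poly f1 y = 0" using e by auto
        then show False using root_f1[of y] \<open>y > a\<close> by simp
      qed
    next
      case False
      show ?thesis by (rule less_imp_le[OF off_a[OF False]])
    qed
    have "dress.row_factors (to_fract f1 / to_fract (X2_plus_1 ^ n)) (to_fract h1 / to_fract (X2_plus_1 ^ n))"
    proof (rule row_factors_no_sign_change[OF _ _ _ nz1 e sign])
      show "poly h1 x \<noteq> 0" if "poly f1 x = 0" for x using not_both root_f1[OF that] that by blast
      show "degree f1 \<le> 2 * n" "degree h1 \<le> 2 * n" "degree f1 = 2 * n \<or> degree h1 = 2 * n"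
        using n by (auto simp: M_def max_def split: if_splits)
    qed
    then show ?thesis by (rule reduce) (use n deg1 deg_g in \<open>auto simp: M_def max_def split: if_splits\<close>)
  qed
qed

lemma row_factors_unique_root:
  assumes pq: "p \<in> dress_ring" "q \<in> dress_ring" "odd (rat_degree p)" "odd (rat_degree q)"
    and root: "\<exists>!a. rat_root p a"
  shows "dress.row_factors p q"
proof -
  obtain f0 k where p0: "rootless k" "degree f0 \<le> degree k" "p = Fract f0 k"
    using dress_ring_imp_Fract[OF pq(1)] by blast
  obtain h0 l where q0: "rootless l" "degree h0 \<le> degree l" "q = Fract h0 l"
    using dress_ring_imp_Fract[OF pq(2)] by blast
  define f h g where "f = f0 * l" and "h = h0 * k" and "g = k * l"
  have nz: "k \<noteq> 0" "l \<noteq> 0" using p0 q0 rootless_nonzero by auto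
  have g: "rootless g" "g \<noteq> 0" using p0 q0 nz rootless_mult by (auto simp: g_def)
  have p: "p = Fract f g"
    unfolding p0(3) f_def g_def using nz by (simp add: eq_fract)
  have q: "q = Fract h g"
    unfolding q0(3) h_def g_def using nz by (simp add: eq_fract)
  have "p \<noteq> 0" "q \<noteq> 0" using pq(3,4) by (auto simp: rat_degree_zero)
  then have nz': "f \<noteq> 0" "h \<noteq> 0" unfolding p q Fract_conv_to_fract by auto
  have odd: "odd (degree f)" "odd (degree h)"
    using pq(3,4) rootless_even_degree[OF g(1)]
    unfolding p q rat_degree_Fract[OF nz'(1) g(2)] rat_degree_Fract[OF nz'(2) g(2)] by simp_all
  have le: "degree f \<le> degree g" "degree h \<le> degree g"
    using p0 q0 nz degree_mult_le[of f0 l] degree_mult_le[of h0 k]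
    by (auto simp: f_def h_def g_def degree_mult_eq)
  obtain a where a: "\<And>x. rat_root p x \<longleftrightarrow> x = a" using root by blast
  have "poly f x = 0 \<longleftrightarrow> x = a" for x
    using a[of x] rat_root_Fract[of g x f] g(1) by (simp add: p rootless_def)
  from row_factors_odd_degrees[OF g(1) odd(1) le(1) this odd(2) le(2)]
  show ?thesis by (simp add: p q Fract_conv_to_fract)
qed

theorem theorem3p8:
  fixes p q :: "real poly fract"
  assumes "p \<in> dress_ring" and "q \<in> dress_ring"
    and "odd (rat_degree p)" and "odd (rat_degree q)"
    and "(\<exists>!a. rat_root p a) \<or> (\<exists>!a. rat_root q a)"
  shows "product_of_idempotents_over dress_ring
           (vector [vector [p, q], vector [0, 0]] :: real poly fract ^ 2 ^ 2)"
  using assms(5)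
proof
  assume "\<exists>!a. rat_root p a"
  with assms have "dress.row_factors p q" by (intro row_factors_unique_root)
  then show ?thesis by (simp only: mat2_def)
next
  assume "\<exists>!a. rat_root q a"
  with assms have "dress.row_factors q p" by (intro row_factors_unique_root)
  from dress.row_factors_swap[OF this] show ?thesis by (simp only: mat2_def)
qed

end
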